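(* Let $A$ be a unital Banach algebra, and let $a,b\in A$ be two EP elements such that $ab$ has a Moore-Penrose inverse. (i) If $(ab)^{-1}(0)=a^{-1}(0)+b^{-1}(0)$ and $abA=aA\cap bA$, then $ab$ is EP. (ii) If $ab$ is EP, then $abA\subseteq bA$ and $a^{-1}(0)\subseteq(ab)^{-1}(0)$. (iii) $abA\subseteq bA$ if and only if $(e-bb^{\dagger})ab=0$; and $a^{-1}(0)\subseteq(ab)^{-1}(0)$ if and only if $ab(e-a^{\dagger}a)=0$. (iv) If $(e-bb^{\dagger})ab=0$, $ab(e-a^{\dagger}a)=0$, and $a^{-1}(0)$ and $b^{-1}(0)$ are finite dimensional, then $(ab)^{-1}(0)=a^{-1}(0)+b^{-1}(0)$ and $abA=aA\cap bA$. In particular, $ab$ is EP. (v) If $(ab)_{-1}(0)=a_{-1}(0)+b_{-1}(0)$ and $Aab=Aa\cap Ab$, then $ab$ is EP. (vi) If $ab$ is EP, then $Aab\subseteq Aa$ and $b_{-1}(0)\subseteq(ab)_{-1}(0)$. (vii) $Aab\subseteq Aa$ if and only if $ab(e-aa^{\dagger})=0$; and $b_{-1}(0)\subseteq(ab)_{-1}(0)$ if and only if $(e-b^{\dagger}b)ab=0$. (viii) If $ab(e-aa^{\dagger})=0$, $(e-b^{\dagger}b)ab=0$, and $a_{-1}(0)$ and $b_{-1}(0)$ are finite dimensional, then $(ab)_{-1}(0)=a_{-1}(0)+b_{-1}(0)$ and $Aab=Aa\cap Ab$. In particular, $ab$ is EP.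
   Context: Scalars are complex. A unital Banach algebra $A$ has a unit $e$ with $\|e\|=1$. For $c\in A$: $c^{-1}(0)=\{x\in A: cx=0\}$, $c_{-1}(0)=\{x\in A: xc=0\}$, $cA=\{cx:x\in A\}$, $Ac=\{xc:x\in A\}$. An element $h\in A$ is hermitian if $\|\exp(ith)\|=1$ for all $t\in\mathbb{R}$. The Moore-Penrose inverse of $a\in A$, denoted $a^{\dagger}$, is the (at most one) $x\in A$ with $a=axa$, $x=xax$, and $ax$ and $xa$ hermitian. An element $a$ is EP if $a^{\dagger}$ exists and $aa^{\dagger}=a^{\dagger}a$. *)

theory Defs
  imports "HOL-Analysis.Analysis" "HOL-Library.Set_Algebras"
begin

text \<open>
  The library only has real Banach algebras. The class below adds a complex scalar
  multiplication that extends the real one and is compatible with the product and with the norm.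
  The class \<^class>\<open>real_normed_algebra_1\<close> already contains submultiplicativity of the
  norm and \<open>norm 1 = 1\<close>; completeness comes from \<^class>\<open>banach\<close>.
\<close>

class complex_banach_algebra_1 = real_normed_algebra_1 + banach +
  fixes scaleC :: "complex \<Rightarrow> 'a \<Rightarrow> 'a"  (infixr \<open>*\<^sub>C\<close> 75)
  assumes scaleC_add_right: "c *\<^sub>C (x + y) = c *\<^sub>C x + c *\<^sub>C y"
    and scaleC_add_left: "(c + d) *\<^sub>C x = c *\<^sub>C x + d *\<^sub>C x"
    and scaleC_scaleC: "c *\<^sub>C d *\<^sub>C x = (c * d) *\<^sub>C x"
    and scaleC_of_real: "complex_of_real r *\<^sub>C x = r *\<^sub>R x"
    and mult_scaleC_left: "c *\<^sub>C x * y = c *\<^sub>C (x * y)"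
    and mult_scaleC_right: "x * c *\<^sub>C y = c *\<^sub>C (x * y)"
    and norm_scaleC: "norm (c *\<^sub>C x) = cmod c * norm x"

lemma scaleC_one: "1 *\<^sub>C x = (x :: 'a :: complex_banach_algebra_1)"
  using scaleC_of_real[of 1 x] by simp

global_interpretation complex_vector:
  vector_space "scaleC :: complex \<Rightarrow> 'a \<Rightarrow> 'a :: complex_banach_algebra_1"
  by unfold_locales (simp_all add: scaleC_add_right scaleC_add_left scaleC_scaleC scaleC_one)

instantiation complex :: complex_banach_algebra_1
begin

definition scaleC_complex :: "complex \<Rightarrow> complex \<Rightarrow> complex"
  where "scaleC_complex c x = c * x"

instance
  by standard (simp_all add: scaleC_complex_def algebra_simps norm_mult scaleR_conv_of_real)

end

text \<open>Finite dimension is meant over the complex numbers and is applied to linear subspaces.\<close>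

definition finite_dim :: "'a::complex_banach_algebra_1 set \<Rightarrow> bool"
  where "finite_dim S \<longleftrightarrow> (\<exists>B. finite B \<and> complex_vector.span B = S)"

text \<open>
  In the usual notation, \<open>right_null c\<close> is $c^{-1}(0)$, \<open>left_null c\<close> is $c_{-1}(0)$,
  \<open>right_range c\<close> is $cA$ and \<open>left_range c\<close> is $Ac$, so
  ``right'' means that the variable stands to the right of \<open>c\<close>.
\<close>

definition right_null :: "'a::complex_banach_algebra_1 \<Rightarrow> 'a set"
  where "right_null c = {x. c * x = 0}"

definition left_null :: "'a::complex_banach_algebra_1 \<Rightarrow> 'a set"
  where "left_null c = {x. x * c = 0}"

definition right_range :: "'a::complex_banach_algebra_1 \<Rightarrow> 'a set"
  where "right_range c = {c * x | x. True}"

definition left_range :: "'a::complex_banach_algebra_1 \<Rightarrow> 'a set"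
  where "left_range c = {x * c | x. True}"

definition hermitian :: "'a::complex_banach_algebra_1 \<Rightarrow> bool"
  where "hermitian h \<longleftrightarrow> (\<forall>t::real. norm (exp ((\<i> * complex_of_real t) *\<^sub>C h)) = 1)"

definition is_mp_inverse :: "'a::complex_banach_algebra_1 \<Rightarrow> 'a \<Rightarrow> bool"
  where "is_mp_inverse a x \<longleftrightarrow>
    a = a * x * a \<and> x = x * a * x \<and> hermitian (a * x) \<and> hermitian (x * a)"

definition mp_invertible :: "'a::complex_banach_algebra_1 \<Rightarrow> bool"
  where "mp_invertible a \<longleftrightarrow> (\<exists>x. is_mp_inverse a x)"

text \<open>Unspecified unless \<open>a\<close> is \<open>mp_invertible\<close>; see \<open>is_mp_inverse_unique\<close> below.\<close>

definition mp_inverse :: "'a::complex_banach_algebra_1 \<Rightarrow> 'a"  (\<open>_\<^sup>\<dagger>\<close> [1000] 999)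
  where "a\<^sup>\<dagger> = (THE x. is_mp_inverse a x)"

definition EP :: "'a::complex_banach_algebra_1 \<Rightarrow> bool"
  where "EP a \<longleftrightarrow> mp_invertible a \<and> a * a\<^sup>\<dagger> = a\<^sup>\<dagger> * a"

lemma bounded_linear_scaleC_left: "bounded_linear (\<lambda>c. c *\<^sub>C (x :: 'a :: complex_banach_algebra_1))"
proof (rule bounded_linear_intro)
  show "(c + d) *\<^sub>C x = c *\<^sub>C x + d *\<^sub>C x" for c d by (rule scaleC_add_left)
  show "(r *\<^sub>R c) *\<^sub>C x = r *\<^sub>R c *\<^sub>C x" for r c
    by (simp only: scaleR_conv_of_real[of r c] scaleC_scaleC[symmetric] scaleC_of_real)
  show "norm (c *\<^sub>C x) \<le> norm c * norm x" for c by (simp add: norm_scaleC)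
qed

lemma exp_scaleC_idempotent:
  fixes p :: "'a :: complex_banach_algebra_1"
  assumes p: "p * p = p"
  shows "exp (c *\<^sub>C p) = 1 + (exp c - 1) *\<^sub>C p"
proof -
  have pow: "(c *\<^sub>C p) ^ Suc n = c ^ Suc n *\<^sub>C p" for n
    by (induction n) (simp_all add: mult_scaleC_left mult_scaleC_right scaleC_scaleC p)
  have 1: "(\<lambda>n. (c ^ n /\<^sub>R fact n) *\<^sub>C p) sums (exp c *\<^sub>C p)"
    by (rule bounded_linear.sums[OF bounded_linear_scaleC_left exp_converges])
  have 2: "(\<lambda>n. if n = 0 then 1 - p else 0) sums (1 - p)"
    using sums_single[of 0 "\<lambda>_. 1 - p"] by simp
  have "(c *\<^sub>C p) ^ n /\<^sub>R fact n =
      (c ^ n /\<^sub>R fact n) *\<^sub>C p + (if n = 0 then 1 - p else 0)" for n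
  proof (cases n)
    case 0
    then show ?thesis by simp
  next
    case (Suc m)
    have "(c ^ n /\<^sub>R fact n) *\<^sub>C p = (c ^ n *\<^sub>C p) /\<^sub>R fact n"
      by (rule linear_scale[OF bounded_linear.linear[OF bounded_linear_scaleC_left]])
    then show ?thesis using pow[of m] Suc by (simp del: power_Suc)
  qed
  with sums_add[OF 1 2] have "(\<lambda>n. (c *\<^sub>C p) ^ n /\<^sub>R fact n) sums (exp c *\<^sub>C p + (1 - p))"
    by simp
  with exp_converges[of "c *\<^sub>C p"] have "exp (c *\<^sub>C p) = exp c *\<^sub>C p + (1 - p)"
    using sums_unique2 by blast
  then show ?thesis
    by (simp add: complex_vector.scale_left_diff_distrib)
qed

lemma square_zero_bounded_imp_zero:
  fixes n :: "'a :: complex_banach_algebra_1"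
  assumes nn: "n * n = 0" and le: "norm (1 - 2 * n) \<le> 1"
  shows "n = 0"
proof (rule ccontr)
  assume "n \<noteq> 0"
  have pow: "(1 - 2 * n) ^ k = 1 - (2 * real k) *\<^sub>R n" for k
  proof (induction k)
    case (Suc k)
    have "2 * n = 2 *\<^sub>R n" by (simp add: scaleR_conv_of_real)
    then have "(1 - 2 * n) ^ Suc k = (1 - 2 *\<^sub>R n) * (1 - (2 * real k) *\<^sub>R n)"
      using Suc by simp
    also have "\<dots> = 1 - (2 * real (Suc k)) *\<^sub>R n"
      by (simp add: algebra_simps nn)
    finally show ?case .
  qed simp
  have bound: "real k * norm n \<le> 1" for k
  proof -
    have "norm ((1 - 2 * n) ^ k) \<le> 1"
      using norm_power_ineq[of "1 - 2 * n" k] power_le_one[OF norm_ge_zero le, of k] by linarith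
    then have "norm ((2 * real k) *\<^sub>R n) \<le> 2"
      unfolding pow using norm_triangle_ineq4[of 1 "1 - (2 * real k) *\<^sub>R n"] by simp
    then show ?thesis by simp
  qed
  from \<open>n \<noteq> 0\<close> obtain k where "1 < real k * norm n"
    using reals_Archimedean3[of "norm n"] by auto
  with bound[of k] show False by simp
qed

lemma hermitian_idempotent_norm:
  fixes p :: "'a :: complex_banach_algebra_1"
  assumes "hermitian p" "p * p = p"
  shows "norm (1 - 2 * p) = 1"
proof -
  have "(-2) *\<^sub>C p = - (2 * p)"
    using scaleC_of_real[of "-2" p] by (simp add: scaleR_conv_of_real)
  then have "exp ((\<i> * complex_of_real pi) *\<^sub>C p) = 1 - 2 * p"
    using exp_scaleC_idempotent[OF assms(2), of "\<i> * complex_of_real pi"]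
    by simp
  then show ?thesis using assms(1) unfolding hermitian_def by metis
qed

lemma hermitian_idempotents_same_range:
  fixes p q :: "'a :: complex_banach_algebra_1"
  assumes p: "hermitian p" "p * p = p" and q: "hermitian q" "q * q = q"
    and pq: "p * q = q" and qp: "q * p = p"
  shows "p = q"
proof -
  have "(1 - 2 * p) * (1 - 2 * q) = 1 - 2 * (p - q)"
    by (simp add: mult_2 algebra_simps pq)
  then have "norm (1 - 2 * (p - q)) \<le> 1"
    using norm_mult_ineq[of "1 - 2 * p" "1 - 2 * q"]
    by (simp add: hermitian_idempotent_norm p q)
  moreover have "(p - q) * (p - q) = 0" by (simp add: algebra_simps p q pq qp)
  ultimately have "p - q = 0" by (rule square_zero_bounded_imp_zero[rotated])
  then show ?thesis by simp
qed

lemma hermitian_idempotents_same_kernel: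
  fixes p q :: "'a :: complex_banach_algebra_1"
  assumes p: "hermitian p" "p * p = p" and q: "hermitian q" "q * q = q"
    and pq: "p * q = p" and qp: "q * p = q"
  shows "p = q"
proof -
  have "(1 - 2 * q) * (1 - 2 * p) = 1 - 2 * (p - q)"
    by (simp add: mult_2 algebra_simps qp)
  then have "norm (1 - 2 * (p - q)) \<le> 1"
    using norm_mult_ineq[of "1 - 2 * q" "1 - 2 * p"]
    by (simp add: hermitian_idempotent_norm p q)
  moreover have "(p - q) * (p - q) = 0" by (simp add: algebra_simps p q pq qp)
  ultimately have "p - q = 0" by (rule square_zero_bounded_imp_zero[rotated])
  then show ?thesis by simp
qed

lemma is_mp_inverse_unique:
  assumes x: "is_mp_inverse a x" and y: "is_mp_inverse a y"
  shows "x = y"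
proof -
  have axa: "a * x * a = a" and xax: "x * a * x = x" and aya: "a * y * a = a" and yay: "y * a * y = y"
    using x y by (simp_all add: is_mp_inverse_def)
  have 1: "a * x = a * y"
    by (rule hermitian_idempotents_same_range)
      (use x y axa aya in \<open>simp_all add: is_mp_inverse_def mult.assoc[symmetric]\<close>)
  have 2: "x * a = y * a"
    by (rule hermitian_idempotents_same_kernel)
      (use x y axa aya in \<open>simp_all add: is_mp_inverse_def mult.assoc\<close>)
  have "x = x * (a * x)" using xax by (simp add: mult.assoc)
  also have "\<dots> = x * a * y" by (simp add: 1 mult.assoc)
  also have "\<dots> = y" by (simp add: 2 yay)
  finally show ?thesis .
qed

lemma mp_inverse_eqI: "is_mp_inverse a x \<Longrightarrow> a\<^sup>\<dagger> = x"
  unfolding mp_inverse_def by (blast intro: is_mp_inverse_unique)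

lemma is_mp_inverse_mp_inverse: "mp_invertible a \<Longrightarrow> is_mp_inverse a (a\<^sup>\<dagger>)"
  unfolding mp_invertible_def using mp_inverse_eqI by metis

end

theory Submission
  imports Defs
begin

text \<open>
  Write \<open>p = a a\<^sup>\<dagger>\<close>, \<open>q = b b\<^sup>\<dagger>\<close>, \<open>c = a b\<close>. If \<open>p\<close> and \<open>q\<close> are hermitian
  idempotents and one of them leaves the range or the kernel of the other invariant, then they
  commute: the commutator of the reflections \<open>1 - 2 p\<close> and \<open>1 - 2 q\<close> is a contraction of the form
  \<open>1 + n\<close> with \<open>n\<^sup>2 = 0\<close>, which forces \<open>n = 0\<close>. Hence each of \<open>p c = c\<close> and
  \<open>c p = c\<close> makes \<open>p\<close> commute with the corresponding projection \<open>c c\<^sup>\<dagger>\<close> or \<open>c\<^sup>\<dagger> c\<close>,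
  and (i), (ii), (v), (vi) follow by computing with commuting projections.

  For (iv), \<open>b\<close> maps the finite-dimensional space \<open>q (a\<^sup>-\<^sup>1(0))\<close> injectively into
  \<open>a\<^sup>-\<^sup>1(0) \<inter> b A\<close>, which is contained in that same space. So all these spaces coincide; this
  gives the kernel of \<open>c\<close> and also \<open>p q (1 - p) = 0\<close>, so that \<open>p\<close> and \<open>q\<close> commute.
  The range of \<open>c\<close> comes from the same count for the compression \<open>(1 - q) a\<close>, which is onto
  \<open>p (b\<^sup>-\<^sup>1(0))\<close>. This is linear algebra about two operators on a vector space, and it is applied
  to left multiplications by \<open>a, b\<close> and to right multiplications by \<open>b, a\<close>.
\<close>

section \<open>Commuting hermitian idempotents\<close>

lemma contractive_reflections_commute:
  fixes p q :: "'a :: complex_banach_algebra_1"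
  assumes p: "norm (1 - 2 * p) \<le> 1" "p * p = p" and q: "norm (1 - 2 * q) \<le> 1" "q * q = q"
    and pqp: "p * q * p = p * q"
  shows "p * q = q * p"
proof -
  \<comment> \<open>The hypothesis gives \<open>L * p = L\<close> and \<open>p * L = 0\<close>;
    hence \<open>L * u = - L\<close>, and both \<open>L * L\<close> and \<open>L * q * L\<close>
    vanish.\<close>
  define u v L where "u = 1 - 2 * p" and "v = 1 - 2 * q" and "L = q * p - p * q"
  have vv: "v * v = 1" and uu: "u * u = 1"
    using p q by (simp_all add: u_def v_def mult_2 algebra_simps)
  have pp': "p * (p * x) = p * x" and qq': "q * (q * x) = q * x"
    and pqp': "p * (q * (p * x)) = p * (q * x)" and pqp'': "p * (q * p) = p * q" for x
    using p q pqp by (simp_all add: mult.assoc[symmetric])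
  have "u * v = v * u - (L + L + L + L)"
    by (simp add: u_def v_def L_def mult_2 algebra_simps)
  then have "u * v * (u * v) = (v * u - (L + L + L + L)) * (u * v)" by simp
  also have "\<dots> = v * (u * u) * v - (L * u * v + L * u * v + L * u * v + L * u * v)"
    by (simp add: algebra_simps)
  also have "L * u = - L"
    by (simp add: u_def L_def mult_2 algebra_simps p(2) q(2) pp' qq' pqp' pqp'')
  \<comment> \<open>This is \<open>1 + 4 * L * v\<close>, written in the shape that
    \<open>square_zero_bounded_imp_zero\<close> expects.\<close>
  finally have comm: "u * v * (u * v) = 1 - 2 * (- (2 * (L * v)))"
    by (simp add: vv uu mult_2 algebra_simps)
  have "norm (u * v) \<le> 1"
    using norm_mult_ineq[of u v] mult_le_one[OF p(1) norm_ge_zero q(1)]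
    by (simp add: u_def v_def)
  then have "norm (u * v * (u * v)) \<le> 1"
    using norm_mult_ineq[of "u * v" "u * v"] mult_le_one[of "norm (u * v)" "norm (u * v)"] by simp
  then have 1: "norm (1 - 2 * (- (2 * (L * v)))) \<le> 1" by (simp only: comm)
  have "L * v * L = 0"
    by (simp add: v_def L_def mult_2 algebra_simps p(2) q(2) pp' qq' pqp' pqp'')
  then have 2: "- (2 * (L * v)) * - (2 * (L * v)) = 0"
    by (simp add: mult_2 algebra_simps) (simp flip: mult.assoc)
  have "- (2 * (L * v)) = 0"
    by (rule square_zero_bounded_imp_zero[OF 2 1])
  then have "2 *\<^sub>R (L * v) = 0" by (simp add: scaleR_conv_of_real)
  then have "L * (v * v) = 0" by (simp flip: mult.assoc)
  then show ?thesis by (simp add: vv L_def)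
qed

lemma hermitian_idempotents_commute_kernel:
  fixes p q :: "'a :: complex_banach_algebra_1"
  assumes "hermitian p" "p * p = p" "hermitian q" "q * q = q" "p * q * p = p * q"
  shows "p * q = q * p"
  using assms by (intro contractive_reflections_commute) (simp_all add: hermitian_idempotent_norm)

text \<open>The reflection of \<open>1 - p\<close> is minus that of \<open>p\<close>, hence still a
  contraction, and the hypothesis turns into the kernel condition for \<open>1 - p\<close>.\<close>

lemma hermitian_idempotents_commute_range:
  fixes p q :: "'a :: complex_banach_algebra_1"
  assumes p: "hermitian p" "p * p = p" and q: "hermitian q" "q * q = q" and pqp: "p * q * p = q * p"
  shows "p * q = q * p"
proof -
  have "1 - 2 * (1 - p) = - (1 - 2 * p)" by (simp add: mult_2 algebra_simps)
  then have "norm (1 - 2 * (1 - p)) \<le> 1"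
    using hermitian_idempotent_norm[OF p] by (simp only: norm_minus_cancel)
  then have "(1 - p) * q = q * (1 - p)"
    using p(2) q pqp by (intro contractive_reflections_commute)
      (simp_all add: hermitian_idempotent_norm algebra_simps)
  then show ?thesis by (simp add: algebra_simps)
qed

section \<open>Absorption by the projections of a Moore-Penrose inverse\<close>

lemma mp_inverseD:
  assumes "mp_invertible c"
  shows "c * c\<^sup>\<dagger> * c = c" "c\<^sup>\<dagger> * c * c\<^sup>\<dagger> = c\<^sup>\<dagger>"
    "hermitian (c * c\<^sup>\<dagger>)" "hermitian (c\<^sup>\<dagger> * c)"
    "c * c\<^sup>\<dagger> * (c * c\<^sup>\<dagger>) = c * c\<^sup>\<dagger>" "c\<^sup>\<dagger> * c * (c\<^sup>\<dagger> * c) = c\<^sup>\<dagger> * c"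
proof -
  show 1: "c * c\<^sup>\<dagger> * c = c" "c\<^sup>\<dagger> * c * c\<^sup>\<dagger> = c\<^sup>\<dagger>" "hermitian (c * c\<^sup>\<dagger>)" "hermitian (c\<^sup>\<dagger> * c)"
    using is_mp_inverse_mp_inverse[OF assms] by (simp_all add: is_mp_inverse_def)
  show "c * c\<^sup>\<dagger> * (c * c\<^sup>\<dagger>) = c * c\<^sup>\<dagger>" "c\<^sup>\<dagger> * c * (c\<^sup>\<dagger> * c) = c\<^sup>\<dagger> * c"
    by (simp_all add: 1 flip: mult.assoc)
qed

text \<open>Commutation moves an absorption from one side of the range projection to the
  other.\<close>

lemma mp_range_projection_absorb:
  fixes c p :: "'a :: complex_banach_algebra_1"
  assumes "mp_invertible c" "hermitian p" "p * p = p" "p * c = c"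
  shows "c * c\<^sup>\<dagger> * p = c * c\<^sup>\<dagger>"
proof -
  have *: "p * (c * c\<^sup>\<dagger>) = c * c\<^sup>\<dagger>" using assms(4) by (simp flip: mult.assoc)
  then have "p * (c * c\<^sup>\<dagger>) = c * c\<^sup>\<dagger> * p"
    using assms mp_inverseD[OF assms(1)] by (intro hermitian_idempotents_commute_range) simp_all
  with * show ?thesis by simp
qed

lemma mp_support_projection_absorb:
  fixes c p :: "'a :: complex_banach_algebra_1"
  assumes "mp_invertible c" "hermitian p" "p * p = p" "c * p = c"
  shows "p * (c\<^sup>\<dagger> * c) = c\<^sup>\<dagger> * c"
proof -
  have *: "c\<^sup>\<dagger> * c * p = c\<^sup>\<dagger> * c" using assms(4) by (simp add: mult.assoc)
  then have "p * (c\<^sup>\<dagger> * c) = c\<^sup>\<dagger> * c * p"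
    using assms mp_inverseD[OF assms(1)]
    by (intro hermitian_idempotents_commute_kernel) (simp_all add: mult.assoc)
  with * show ?thesis by simp
qed

lemma EPD:
  assumes "EP a"
  shows "mp_invertible a" "a * a\<^sup>\<dagger> = a\<^sup>\<dagger> * a"
  using assms by (simp_all add: EP_def)

text \<open>Range and support projection of an EP element coincide, so what the first absorbs on its
  right, the second and hence \<open>c\<close> absorb too.\<close>

lemma EP_absorb_right:
  fixes c p :: "'a :: complex_banach_algebra_1"
  assumes "EP c" "hermitian p" "p * p = p" "p * c = c"
  shows "c * p = c"
proof -
  note c = EPD[OF assms(1)]
  have "c * p = c * (c\<^sup>\<dagger> * c * p)" using mp_inverseD(1)[OF c(1)] by (simp flip: mult.assoc)
  also have "c\<^sup>\<dagger> * c * p = c * c\<^sup>\<dagger>"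
    using mp_range_projection_absorb[OF c(1) assms(2-4)] c(2) by simp
  finally show ?thesis using mp_inverseD(1)[OF c(1)] by (metis c(2) mult.assoc)
qed

lemma EP_absorb_left:
  fixes c p :: "'a :: complex_banach_algebra_1"
  assumes "EP c" "hermitian p" "p * p = p" "c * p = c"
  shows "p * c = c"
proof -
  note c = EPD[OF assms(1)]
  have "p * c = p * (c * c\<^sup>\<dagger>) * c" using mp_inverseD(1)[OF c(1)] by (simp add: mult.assoc)
  also have "p * (c * c\<^sup>\<dagger>) = c * c\<^sup>\<dagger>"
    using mp_support_projection_absorb[OF c(1) assms(2-4)] c(2) by simp
  finally show ?thesis using mp_inverseD(1)[OF c(1)] by simp
qed

section \<open>Ranges and null spaces in terms of an inner inverse\<close>

text \<open>\<open>b * x\<close> is an idempotent with the same right range as \<open>b\<close>, so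
  it fixes exactly the elements of that range.\<close>

lemma right_range_subset_iff:
  assumes "b * x * b = b"
  shows "right_range c \<subseteq> right_range b \<longleftrightarrow> b * x * c = c"
proof
  assume "right_range c \<subseteq> right_range b"
  moreover have "c \<in> right_range c" unfolding right_range_def by (auto intro: exI[of _ 1])
  ultimately obtain y where "c = b * y" unfolding right_range_def by auto
  then show "b * x * c = c" using assms by (simp flip: mult.assoc)
next
  assume "b * x * c = c"
  then have "c * y = b * (x * c * y)" for y by (simp flip: mult.assoc)
  then show "right_range c \<subseteq> right_range b" unfolding right_range_def by blast
qed

lemma left_range_subset_iff:
  assumes "a * x * a = a"
  shows "left_range c \<subseteq> left_range a \<longleftrightarrow> c * (x * a) = c"
proof
  assume "left_range c \<subseteq> left_range a"
  moreover have "c \<in> left_range c" unfolding left_range_def by (auto intro: exI[of _ 1])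
  ultimately obtain y where "c = y * a" unfolding left_range_def by auto
  then show "c * (x * a) = c" using assms by (simp add: mult.assoc)
next
  assume *: "c * (x * a) = c"
  have "y * c = y * c * x * a" for y using arg_cong[OF *, of "(*) y"] by (simp add: mult.assoc)
  then show "left_range c \<subseteq> left_range a" unfolding left_range_def by blast
qed

text \<open>The right null space of \<open>a\<close> is the right ideal generated by
  \<open>1 - x * a\<close>, so this single element decides the inclusion.\<close>

lemma right_null_subset_iff:
  assumes "a * x * a = a"
  shows "right_null a \<subseteq> right_null c \<longleftrightarrow> c * (x * a) = c"
proof
  assume "right_null a \<subseteq> right_null c"
  moreover have "1 - x * a \<in> right_null a"
    using assms by (simp add: right_null_def algebra_simps)
  ultimately have "c * (1 - x * a) = 0" unfolding right_null_def by blast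
  then show "c * (x * a) = c" by (simp add: right_diff_distrib)
next
  assume "c * (x * a) = c"
  then have "c * y = 0" if "a * y = 0" for y using that by (metis mult.assoc mult_zero_right)
  then show "right_null a \<subseteq> right_null c" by (auto simp: right_null_def)
qed

lemma left_null_subset_iff:
  assumes "b * x * b = b"
  shows "left_null b \<subseteq> left_null c \<longleftrightarrow> b * x * c = c"
proof
  assume "left_null b \<subseteq> left_null c"
  moreover have "1 - b * x \<in> left_null b"
    using assms by (simp add: left_null_def algebra_simps)
  ultimately have "(1 - b * x) * c = 0" unfolding left_null_def by blast
  then show "b * x * c = c" by (simp add: left_diff_distrib)
next
  assume "b * x * c = c"
  then have "y * c = 0" if "y * b = 0" for y using that by (metis mult.assoc mult_zero_left)
  then show "left_null b \<subseteq> left_null c" by (auto simp: left_null_def)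
qed

section \<open>EP elements from a sum of null spaces and an intersection of ranges\<close>

lemma EP_product_right:
  fixes a b c :: "'a :: complex_banach_algebra_1"
  assumes a: "EP a" and b: "EP b" and c: "mp_invertible c"
    and null: "right_null c = right_null a + right_null b"
    and range: "right_range c = right_range a \<inter> right_range b"
  shows "EP c"
proof -
  note ma = mp_inverseD[OF EPD(1)[OF a]] and mb = mp_inverseD[OF EPD(1)[OF b]]
    and mc = mp_inverseD[OF c]
  \<comment> \<open>Null spaces first: the support projection of \<open>c\<close> lies in the ranges
    of \<open>a\<close> and \<open>b\<close>, hence in that of \<open>c\<close>, where
    \<open>c * c\<^sup>\<dagger>\<close> acts as the identity.\<close>
  have "right_null a \<subseteq> right_null c" "right_null b \<subseteq> right_null c"
    unfolding null by (force simp: set_plus_def right_null_def)+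
  then have "c * (a\<^sup>\<dagger> * a) = c" "c * (b\<^sup>\<dagger> * b) = c"
    using right_null_subset_iff ma(1) mb(1) by blast+
  then have "a\<^sup>\<dagger> * a * (c\<^sup>\<dagger> * c) = c\<^sup>\<dagger> * c" "b\<^sup>\<dagger> * b * (c\<^sup>\<dagger> * c) = c\<^sup>\<dagger> * c"
    by (simp_all add: c ma mb mp_support_projection_absorb)
  then have "c\<^sup>\<dagger> * c = a * (a\<^sup>\<dagger> * (c\<^sup>\<dagger> * c))" "c\<^sup>\<dagger> * c = b * (b\<^sup>\<dagger> * (c\<^sup>\<dagger> * c))"
    unfolding EPD(2)[OF a, symmetric] EPD(2)[OF b, symmetric] by (simp_all add: mult.assoc)
  then have "c\<^sup>\<dagger> * c \<in> right_range a \<inter> right_range b"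
    unfolding right_range_def by blast
  then have "c\<^sup>\<dagger> * c \<in> right_range c" unfolding range .
  then obtain y where "c\<^sup>\<dagger> * c = c * y" by (auto simp: right_range_def)
  then have 1: "c * c\<^sup>\<dagger> * (c\<^sup>\<dagger> * c) = c\<^sup>\<dagger> * c" using mc(1) by (simp flip: mult.assoc)

  \<comment> \<open>Now ranges: \<open>c * c\<^sup>\<dagger>\<close> kills the null spaces of
    \<open>a\<close> and \<open>b\<close>, hence their sum, which contains
    \<open>1 - c\<^sup>\<dagger> * c\<close>.\<close>
  have "right_range c \<subseteq> right_range a" "right_range c \<subseteq> right_range b" using range by auto
  then have "a * a\<^sup>\<dagger> * c = c" "b * b\<^sup>\<dagger> * c = c"
    using right_range_subset_iff ma(1) mb(1) by blast+
  then have "c * c\<^sup>\<dagger> * (a * a\<^sup>\<dagger>) = c * c\<^sup>\<dagger>" "c * c\<^sup>\<dagger> * (b * b\<^sup>\<dagger>) = c * c\<^sup>\<dagger>"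
    by (simp_all add: c ma mb mp_range_projection_absorb)
  then have kill: "c * c\<^sup>\<dagger> * u = c * c\<^sup>\<dagger> * a\<^sup>\<dagger> * (a * u)" "c * c\<^sup>\<dagger> * u = c * c\<^sup>\<dagger> * b\<^sup>\<dagger> * (b * u)" for u
    unfolding EPD(2)[OF a] EPD(2)[OF b] by (simp_all flip: mult.assoc)
  have "1 - c\<^sup>\<dagger> * c \<in> right_null c"
    using mc(1) by (simp add: right_null_def algebra_simps)
  then obtain u v where "1 - c\<^sup>\<dagger> * c = u + v" "a * u = 0" "b * v = 0"
    unfolding null by (auto elim!: set_plus_elim simp: right_null_def)
  then have "c * c\<^sup>\<dagger> * (1 - c\<^sup>\<dagger> * c) = 0"
    using kill(1)[of u] kill(2)[of v] by (simp add: distrib_left)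
  with 1 have "c * c\<^sup>\<dagger> = c\<^sup>\<dagger> * c" by (simp add: right_diff_distrib)
  with c show ?thesis by (simp add: EP_def)
qed

text \<open>The preceding argument with multiplication reversed:
  \<open>c * c\<^sup>\<dagger>\<close> lands in \<open>left_range c\<close>, and both left null
  spaces annihilate \<open>c\<^sup>\<dagger> * c\<close>.\<close>

lemma EP_product_left:
  fixes a b c :: "'a :: complex_banach_algebra_1"
  assumes a: "EP a" and b: "EP b" and c: "mp_invertible c"
    and null: "left_null c = left_null a + left_null b"
    and range: "left_range c = left_range a \<inter> left_range b"
  shows "EP c"
proof -
  note ma = mp_inverseD[OF EPD(1)[OF a]] and mb = mp_inverseD[OF EPD(1)[OF b]]
    and mc = mp_inverseD[OF c]
  have "left_null a \<subseteq> left_null c" "left_null b \<subseteq> left_null c"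
    unfolding null by (force simp: set_plus_def left_null_def)+
  then have "a * a\<^sup>\<dagger> * c = c" "b * b\<^sup>\<dagger> * c = c"
    using left_null_subset_iff ma(1) mb(1) by blast+
  then have "c * c\<^sup>\<dagger> * (a * a\<^sup>\<dagger>) = c * c\<^sup>\<dagger>" "c * c\<^sup>\<dagger> * (b * b\<^sup>\<dagger>) = c * c\<^sup>\<dagger>"
    by (simp_all add: c ma mb mp_range_projection_absorb)
  then have "c * c\<^sup>\<dagger> = (c * c\<^sup>\<dagger> * a\<^sup>\<dagger>) * a" "c * c\<^sup>\<dagger> = (c * c\<^sup>\<dagger> * b\<^sup>\<dagger>) * b"
    unfolding EPD(2)[OF a] EPD(2)[OF b] by (simp_all add: mult.assoc)
  then have "c * c\<^sup>\<dagger> \<in> left_range a \<inter> left_range b"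
    unfolding left_range_def by blast
  then have "c * c\<^sup>\<dagger> \<in> left_range c" unfolding range .
  then obtain y where y: "c * c\<^sup>\<dagger> = y * c" by (auto simp: left_range_def)
  have "y * c * (c\<^sup>\<dagger> * c) = y * c" using mc(1) by (simp add: mult.assoc)
  with y have 1: "c * c\<^sup>\<dagger> * (c\<^sup>\<dagger> * c) = c * c\<^sup>\<dagger>" by simp

  have "left_range c \<subseteq> left_range a" "left_range c \<subseteq> left_range b" using range by auto
  then have "c * (a\<^sup>\<dagger> * a) = c" "c * (b\<^sup>\<dagger> * b) = c"
    using left_range_subset_iff ma(1) mb(1) by blast+
  then have "a\<^sup>\<dagger> * a * (c\<^sup>\<dagger> * c) = c\<^sup>\<dagger> * c" "b\<^sup>\<dagger> * b * (c\<^sup>\<dagger> * c) = c\<^sup>\<dagger> * c"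
    by (simp_all add: c ma mb mp_support_projection_absorb)
  then have "a * (a\<^sup>\<dagger> * (c\<^sup>\<dagger> * c)) = c\<^sup>\<dagger> * c" "b * (b\<^sup>\<dagger> * (c\<^sup>\<dagger> * c)) = c\<^sup>\<dagger> * c"
    unfolding EPD(2)[OF a, symmetric] EPD(2)[OF b, symmetric] by (simp_all add: mult.assoc)
  then have kill: "u * (c\<^sup>\<dagger> * c) = u * a * (a\<^sup>\<dagger> * (c\<^sup>\<dagger> * c))"
    "u * (c\<^sup>\<dagger> * c) = u * b * (b\<^sup>\<dagger> * (c\<^sup>\<dagger> * c))" for u
    by (simp_all add: mult.assoc)
  have "1 - c * c\<^sup>\<dagger> \<in> left_null c"
    using mc(1) by (simp add: left_null_def algebra_simps)
  then obtain u v where "1 - c * c\<^sup>\<dagger> = u + v" "u * a = 0" "v * b = 0"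
    unfolding null by (auto elim!: set_plus_elim simp: left_null_def)
  then have "(1 - c * c\<^sup>\<dagger>) * (c\<^sup>\<dagger> * c) = 0"
    using kill(1)[of u] kill(2)[of v] by (simp add: distrib_right)
  with 1 have "c * c\<^sup>\<dagger> = c\<^sup>\<dagger> * c" by (simp add: left_diff_distrib)
  with c show ?thesis by (simp add: EP_def)
qed

section \<open>Products of two group invertible operators with finite-dimensional kernels\<close>

context vector_space
begin

interpretation endo: vector_space_pair scale scale
  by unfold_locales

text \<open>The image of a basis is independent and of the same size; a vector outside its span
  would enlarge it beyond the bound for independent sets.\<close>

lemma linear_inj_on_span_imp_surj:
  assumes f: "Vector_Spaces.linear scale scale f" and B: "finite B"
    and into: "f ` span B \<subseteq> span B" and inj: "inj_on f (span B)"
  shows "f ` span B = span B"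
proof -
  obtain C where C: "C \<subseteq> B" "independent C" "B \<subseteq> span C"
    using maximal_independent_subset[of B] by metis
  have spanC: "span C = span B"
    using C span_mono span_minimal[OF C(3)] by (meson subset_antisym subspace_span)
  have "finite C" using C(1) B finite_subset by blast
  have "independent (f ` C)"
    using endo.linear_independent_injective_image[OF f C(2)] inj by (simp add: spanC)
  moreover have "f ` C \<subseteq> span C"
    using into span_superset[of C] by (auto simp: spanC)
  moreover have "inj_on f C"
    using inj span_superset[of C] by (auto simp: spanC intro: inj_on_subset)
  ultimately have "x \<in> span (f ` C)" if "x \<in> span C" for x
    using that independent_span_bound[OF \<open>finite C\<close>, of "insert x (f ` C)"] \<open>finite C\<close>
      span_superset[of "f ` C"]
    by (cases "x \<in> f ` C") (auto simp: independent_insert card_image)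
  then have "span B \<subseteq> f ` span B"
    using endo.linear_span_image[OF f, of C] by (auto simp: spanC)
  with into show ?thesis by (simp add: spanC)
qed

text \<open>A linear right inverse is injective, hence onto by the previous lemma, and so is also a
  left inverse.\<close>

lemma linear_surj_on_span_imp_inj:
  assumes f: "Vector_Spaces.linear scale scale f" and B: "finite B"
    and surj: "f ` span B = span B"
  shows "inj_on f (span B)"
proof -
  obtain g where g: "range g \<subseteq> span B" "Vector_Spaces.linear scale scale g"
    "\<And>v. v \<in> span B \<Longrightarrow> f (g v) = v"
    using endo.linear_exists_right_inverse_on[OF f subspace_span, of B] surj by auto
  have gB: "g ` span B = span B"
    using g by (intro linear_inj_on_span_imp_surj B) (auto intro: inj_on_inverseI[of _ f])
  show ?thesis
  proof (rule inj_on_inverseI)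
    fix x assume "x \<in> span B"
    then obtain y where "y \<in> span B" "x = g y" using gB by blast
    then show "g (f x) = x" using g(3) by simp
  qed
qed

end

text \<open>Commuting inner inverses make \<open>f (f' x)\<close> and \<open>g (g' x)\<close>
  projections onto the ranges along the kernels. The two \<open>_subset\<close> assumptions say that
  the composite of \<open>g\<close> followed by \<open>f\<close> absorbs the projection of
  \<open>g\<close> on the left and that of \<open>f\<close> on the right.\<close>

locale group_invertible_pair = vector_space scale
  for scale :: "'f :: field \<Rightarrow> 'v :: ab_group_add \<Rightarrow> 'v" +
  fixes f f' g g' :: "'v \<Rightarrow> 'v"
  assumes linear: "Vector_Spaces.linear scale scale f" "Vector_Spaces.linear scale scale f'"
      "Vector_Spaces.linear scale scale g" "Vector_Spaces.linear scale scale g'"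
    and inner: "f (f' (f x)) = f x" "g (g' (g x)) = g x"
    and comm: "f' (f x) = f (f' x)" "g' (g x) = g (g' x)"
    and range_subset: "g (g' (f (g x))) = f (g x)"
    and kernel_subset: "f (g (f (f' x))) = f (g x)"
    and finite_kernels: "\<exists>B. finite B \<and> span B = {x. f x = 0}" "\<exists>B. finite B \<and> span B = {x. g x = 0}"
begin

interpretation endo: vector_space_pair scale scale
  by unfold_locales

abbreviation "p x \<equiv> f (f' x)"
abbreviation "q x \<equiv> g (g' x)"

lemmas zero [simp] = linear[THEN endo.linear_0]
lemmas diff [simp] = linear[THEN endo.linear_diff]

lemma linear_p: "Vector_Spaces.linear scale scale (\<lambda>x. p x)"
  using Vector_Spaces.linear_compose[OF linear(2,1)] by (simp add: o_def)

lemma linear_q: "Vector_Spaces.linear scale scale (\<lambda>x. q x)"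
  using Vector_Spaces.linear_compose[OF linear(4,3)] by (simp add: o_def)

lemma absorb: "f (p x) = f x" "p (f x) = f x" "g (q x) = g x" "q (g x) = g x"
  using inner comm by metis+

lemma kernel_image:
  assumes "f n = 0"
  obtains m where "f m = 0" "q n = g m"
proof -
  obtain B where B: "finite B" "span B = {x. f x = 0}" using finite_kernels by blast
  have N: "span ((\<lambda>x. q x) ` B) = (\<lambda>x. q x) ` {x. f x = 0}"
    using endo.linear_span_image[OF linear_q] B by simp
  have "p x = 0" if "f x = 0" for x using that comm(1)[of x] by simp
  then have inv: "f (g x) = 0" if "f x = 0" for x
    using that kernel_subset[of x] by simp
  have "g ` span ((\<lambda>x. q x) ` B) = span ((\<lambda>x. q x) ` B)"
  proof (rule linear_inj_on_span_imp_surj[OF linear(3) finite_imageI[OF B(1)]])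
    show "g ` span ((\<lambda>x. q x) ` B) \<subseteq> span ((\<lambda>x. q x) ` B)"
    proof
      fix y assume "y \<in> g ` span ((\<lambda>x. q x) ` B)"
      then obtain x where "f x = 0" "y = g x" unfolding N using absorb by auto
      \<comment> \<open>A vector of the kernel of \<open>f\<close> that \<open>q\<close> fixes is
        its own preimage under \<open>q\<close>.\<close>
      then have "f y = 0" "y = q y" using inv absorb by simp_all
      then show "y \<in> span ((\<lambda>x. q x) ` B)" unfolding N by blast
    qed
    show "inj_on g (span ((\<lambda>x. q x) ` B))"
    proof (rule inj_on_inverseI)
      fix y assume "y \<in> span ((\<lambda>x. q x) ` B)"
      then obtain x where "y = q x" unfolding N by blast
      then show "g' (g y) = y" using absorb by (simp add: comm(2))
    qed
  qed
  \<comment> \<open>Since \<open>g (q x) = g x\<close>, the preimage may be taken in the kernel of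
    \<open>f\<close> itself.\<close>
  then have "q n \<in> g ` (\<lambda>x. q x) ` {x. f x = 0}" unfolding N using assms by blast
  with absorb that show thesis by auto
qed

lemma kernel_invariant:
  assumes "f n = 0"
  shows "f (q n) = 0"
proof -
  obtain m where m: "f m = 0" "q n = g m" using kernel_image[OF assms] .
  moreover have "p m = 0" using m comm(1)[of m] by simp
  ultimately show ?thesis using kernel_subset[of m] by simp
qed

text \<open>\<open>x - p x\<close> lies in the kernel of \<open>f\<close>, which \<open>q\<close>
  preserves. For hermitian projections this identity yields commutation.\<close>

lemma compressed: "p (q (p x)) = p (q x)"
proof -
  have "f (x - p x) = 0" using absorb by simp
  then have "f (q (x - p x)) = 0" by (rule kernel_invariant)
  then have "f' (f (q (x - p x))) = 0" by simp
  then show ?thesis unfolding comm by simp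
qed

lemma kernel_product: "f (g x) = 0 \<longleftrightarrow> (\<exists>m n. f m = 0 \<and> g n = 0 \<and> x = m + n)"
proof
  assume "f (g x) = 0"
  \<comment> \<open>Here \<open>g x\<close> plays the part of the kernel vector and is fixed by
    \<open>q\<close>; so \<open>g x = g m\<close>, and \<open>x - m\<close> is in the kernel of
    \<open>g\<close>.\<close>
  then obtain m where "f m = 0" "q (g x) = g m" by (rule kernel_image)
  then show "\<exists>m n. f m = 0 \<and> g n = 0 \<and> x = m + n"
    using absorb by (intro exI[of _ m] exI[of _ "x - m"]) simp
next
  assume "\<exists>m n. f m = 0 \<and> g n = 0 \<and> x = m + n"
  then obtain m n where mn: "f m = 0" "g n = 0" "x = m + n" by blast
  then have "p m = 0" using comm(1)[of m] by simp
  then show "f (g x) = 0"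
    using mn kernel_subset[of m] linear[THEN endo.linear_add] by simp
qed

lemma range_product:
  assumes commute: "\<And>x. p (q x) = q (p x)"
  shows "range (\<lambda>x. f (g x)) = range f \<inter> range g"
proof
  show "range (\<lambda>x. f (g x)) \<subseteq> range f \<inter> range g"
    using range_eqI[of _ g, OF range_subset[symmetric]] by blast
  show "range f \<inter> range g \<subseteq> range (\<lambda>x. f (g x))"
  proof
    fix x assume "x \<in> range f \<inter> range g"
    then have x: "p x = x" "q x = x" using absorb by auto
    obtain B where B: "finite B" "span B = {x. g x = 0}" using finite_kernels by blast
    \<comment> \<open>The compression of \<open>f\<close> along the range of \<open>g\<close>: it
      vanishes on that range and takes values in the kernel of \<open>g\<close>.\<close>
    define h where "h x = f x - q (f x)" for x
    have h: "Vector_Spaces.linear scale scale h"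
      unfolding h_def
      using endo.linear_compose_sub[OF linear(1) Vector_Spaces.linear_compose[OF linear(1) linear_q]]
      by (simp add: o_def)
    have h_p: "h (p y) = h y" and h_q: "h (q y) = 0" for y
      using absorb range_subset by (simp_all add: h_def)
    define W where "W = (\<lambda>x. p x) ` {x. g x = 0}"
    have W: "span ((\<lambda>x. p x) ` B) = W"
      using endo.linear_span_image[OF linear_p] B by (simp add: W_def)
    have gh: "g (h y) = 0" and ph: "p (h y) = h y" for y
      using absorb by (simp_all add: h_def commute)
    have "h ` W = W"
    proof
      show "h ` W \<subseteq> W"
      proof
        fix y assume "y \<in> h ` W"
        then have "g y = 0" "y = p y" using gh ph by auto
        then show "y \<in> W" unfolding W_def by blast
      qed
      show "W \<subseteq> h ` W"
      proof
        fix w assume "w \<in> W"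
        then obtain m where m: "g m = 0" "w = p m" unfolding W_def by auto
        have "q m = 0" using m comm(2)[of m] by simp
        \<comment> \<open>\<open>f (f' m) = p m\<close>, and the subtracted term is
          \<open>q (p m) = p (q m) = 0\<close>.\<close>
        then have "h (f' m) = w" using m by (simp add: h_def flip: commute)
        \<comment> \<open>Projecting the preimage into \<open>W\<close> leaves its value unchanged,
          by \<open>h_p\<close> and \<open>h_q\<close>.\<close>
        then have "h (p (f' m - q (f' m))) = w"
          using h_q h_p endo.linear_diff[OF h] by simp
        moreover have "p (f' m - q (f' m)) \<in> W"
          unfolding W_def using absorb by (intro imageI) simp
        ultimately show "w \<in> h ` W" by blast
      qed
    qed
    then have inj: "inj_on h W"
      using linear_surj_on_span_imp_inj[OF h, of "(\<lambda>x. p x) ` B"] B by (simp add: W)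
    \<comment> \<open>The part of \<open>f' x\<close> outside the range of \<open>g\<close>. Once
      \<open>f m = 0\<close> is known, \<open>x = f (f' x) = f (q (f' x))\<close>.\<close>
    define m where "m = f' x - q (f' x)"
    have "g m = 0" using absorb by (simp add: m_def)
    then have W_mem: "p m \<in> W" "p 0 \<in> W" unfolding W_def using zero(3) by blast+
    have "h (f' x) = 0" using x by (simp add: h_def)
    then have "h m = 0" using h_q endo.linear_diff[OF h] by (simp add: m_def)
    then have "h (p m) = h (p 0)" by (simp only: h_p endo.linear_0[OF h])
    then have "p m = p 0" using W_mem by (rule inj_onD[OF inj])
    then have "f m = 0" using absorb(1)[of m] by simp
    then have "x = f (g (g' (f' x)))" using x by (simp add: m_def)
    then show "x \<in> range (\<lambda>x. f (g x))" by blast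
  qed
qed

end

section \<open>The product theorem\<close>

lemma linear_mult_left: "Vector_Spaces.linear scaleC scaleC (\<lambda>x. a * x :: 'a :: complex_banach_algebra_1)"
  by unfold_locales (simp_all add: distrib_left mult_scaleC_right)

lemma linear_mult_right: "Vector_Spaces.linear scaleC scaleC (\<lambda>x. x * a :: 'a :: complex_banach_algebra_1)"
  by unfold_locales (simp_all add: distrib_right mult_scaleC_left)

lemma left_mult_EP:
  assumes "EP a"
  shows "a * (a\<^sup>\<dagger> * (a * x)) = a * x" "a\<^sup>\<dagger> * (a * x) = a * (a\<^sup>\<dagger> * x)"
  using mp_inverseD(1)[OF EPD(1)[OF assms]] EPD(2)[OF assms] by (metis mult.assoc)+

lemma right_mult_EP:
  assumes "EP a"
  shows "x * a * a\<^sup>\<dagger> * a = x * a" "x * a * a\<^sup>\<dagger> = x * a\<^sup>\<dagger> * a"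
  using mp_inverseD(1)[OF EPD(1)[OF assms]] EPD(2)[OF assms] by (metis mult.assoc)+

lemma right_null_range_product:
  fixes a b :: "'a :: complex_banach_algebra_1"
  assumes a: "EP a" and b: "EP b"
    and 1: "b * b\<^sup>\<dagger> * (a * b) = a * b" and 2: "a * b * (a\<^sup>\<dagger> * a) = a * b"
    and fin: "finite_dim (right_null a)" "finite_dim (right_null b)"
  shows "right_null (a * b) = right_null a + right_null b"
    "right_range (a * b) = right_range a \<inter> right_range b"
proof -
  note ma = mp_inverseD[OF EPD(1)[OF a]] and mb = mp_inverseD[OF EPD(1)[OF b]]
  have pw: "b * (b\<^sup>\<dagger> * (a * (b * x))) = a * (b * x)"
    "a * (b * (a * (a\<^sup>\<dagger> * x))) = a * (b * x)" for x
  proof -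
    show "b * (b\<^sup>\<dagger> * (a * (b * x))) = a * (b * x)" using 1 by (simp flip: mult.assoc)
    have "a * b * (a * a\<^sup>\<dagger>) = a * b" using 2 EPD(2)[OF a] by simp
    then show "a * (b * (a * (a\<^sup>\<dagger> * x))) = a * (b * x)" by (simp flip: mult.assoc)
  qed
  interpret group_invertible_pair scaleC "(*) a" "(*) (a\<^sup>\<dagger>)" "(*) b" "(*) (b\<^sup>\<dagger>)"
    by (intro group_invertible_pair.intro group_invertible_pair_axioms.intro)
      (fact complex_vector.vector_space_axioms linear_mult_left left_mult_EP[OF a] left_mult_EP[OF b]
        pw fin[unfolded finite_dim_def right_null_def])+
  \<comment> \<open>Evaluating the operator identity at the unit turns it into one between elements
    of the algebra.\<close>
  have "a * a\<^sup>\<dagger> * (b * b\<^sup>\<dagger>) * (a * a\<^sup>\<dagger>) = a * a\<^sup>\<dagger> * (b * b\<^sup>\<dagger>)"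
    using compressed[of 1] by (simp add: mult.assoc)
  then have "a * a\<^sup>\<dagger> * (b * b\<^sup>\<dagger>) = b * b\<^sup>\<dagger> * (a * a\<^sup>\<dagger>)"
    by (intro hermitian_idempotents_commute_kernel ma mb)
  then have "range (\<lambda>x. a * (b * x)) = range ((*) a) \<inter> range ((*) b)"
    by (intro range_product) (simp flip: mult.assoc)
  then show "right_range (a * b) = right_range a \<inter> right_range b"
    by (simp add: right_range_def full_SetCompr_eq mult.assoc)
  show "right_null (a * b) = right_null a + right_null b"
    using kernel_product by (auto simp: right_null_def set_plus_def mult.assoc)
qed

lemma left_null_range_product:
  fixes a b :: "'a :: complex_banach_algebra_1"
  assumes a: "EP a" and b: "EP b"
    and 1: "b * b\<^sup>\<dagger> * (a * b) = a * b" and 2: "a * b * (a\<^sup>\<dagger> * a) = a * b"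
    and fin: "finite_dim (left_null a)" "finite_dim (left_null b)"
  shows "left_null (a * b) = left_null a + left_null b"
    "left_range (a * b) = left_range a \<inter> left_range b"
proof -
  note ma = mp_inverseD[OF EPD(1)[OF a]] and mb = mp_inverseD[OF EPD(1)[OF b]]
  have pw: "x * a * b * a\<^sup>\<dagger> * a = x * a * b"
    "x * b\<^sup>\<dagger> * b * a * b = x * a * b" for x
  proof -
    show "x * a * b * a\<^sup>\<dagger> * a = x * a * b" using 2 by (simp add: mult.assoc)
    have "b\<^sup>\<dagger> * b * (a * b) = a * b" using 1 EPD(2)[OF b] by simp
    then show "x * b\<^sup>\<dagger> * b * a * b = x * a * b" by (simp add: mult.assoc)
  qed
  interpret group_invertible_pair scaleC "\<lambda>x. x * b" "\<lambda>x. x * b\<^sup>\<dagger>" "\<lambda>x. x * a" "\<lambda>x. x * a\<^sup>\<dagger>"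
    by (intro group_invertible_pair.intro group_invertible_pair_axioms.intro)
      (fact complex_vector.vector_space_axioms linear_mult_right right_mult_EP[OF a] right_mult_EP[OF b]
        pw fin[unfolded finite_dim_def left_null_def])+
  \<comment> \<open>Right multiplications compose in reverse order, so the same identity at the unit
    becomes the range condition for \<open>b * b\<^sup>\<dagger>\<close>.\<close>
  have "b * b\<^sup>\<dagger> * (a * a\<^sup>\<dagger>) * (b * b\<^sup>\<dagger>) = a * a\<^sup>\<dagger> * (b * b\<^sup>\<dagger>)"
    using compressed[of 1] EPD(2)[OF a] EPD(2)[OF b] by (simp add: mult.assoc)
  then have "b * b\<^sup>\<dagger> * (a * a\<^sup>\<dagger>) = a * a\<^sup>\<dagger> * (b * b\<^sup>\<dagger>)"
    by (intro hermitian_idempotents_commute_range ma mb)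
  then have "range (\<lambda>x. x * a * b) = range (\<lambda>x. x * b) \<inter> range (\<lambda>x. x * a)"
    using EPD(2)[OF a] EPD(2)[OF b] by (intro range_product) (simp add: mult.assoc)
  then show "left_range (a * b) = left_range a \<inter> left_range b"
    by (auto simp add: left_range_def full_SetCompr_eq mult.assoc)
  have "left_null (a * b) = left_null b + left_null a"
    using kernel_product by (auto simp: left_null_def set_plus_def mult.assoc)
  then show "left_null (a * b) = left_null a + left_null b" by (simp only: add.commute)
qed

theorem theorem22:
  fixes a b :: "'a::complex_banach_algebra_1"
  assumes "EP a" and "EP b" and "mp_invertible (a * b)"
  shows
    \<comment> \<open>(i)\<close>
    "(right_null (a * b) = right_null a + right_null b \<and>
        right_range (a * b) = right_range a \<inter> right_range b
      \<longrightarrow> EP (a * b))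
    \<and> \<comment> \<open>(ii)\<close>
     (EP (a * b) \<longrightarrow>
        right_range (a * b) \<subseteq> right_range b \<and> right_null a \<subseteq> right_null (a * b))
    \<and> \<comment> \<open>(iii)\<close>
     ((right_range (a * b) \<subseteq> right_range b \<longleftrightarrow> (1 - b * b\<^sup>\<dagger>) * a * b = 0) \<and>
      (right_null a \<subseteq> right_null (a * b) \<longleftrightarrow> a * b * (1 - a\<^sup>\<dagger> * a) = 0))
    \<and> \<comment> \<open>(iv)\<close>
     ((1 - b * b\<^sup>\<dagger>) * a * b = 0 \<and> a * b * (1 - a\<^sup>\<dagger> * a) = 0 \<and>
        finite_dim (right_null a) \<and> finite_dim (right_null b)
      \<longrightarrow> right_null (a * b) = right_null a + right_null b \<and>
          right_range (a * b) = right_range a \<inter> right_range b \<and>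
          EP (a * b))
    \<and> \<comment> \<open>(v)\<close>
     (left_null (a * b) = left_null a + left_null b \<and>
        left_range (a * b) = left_range a \<inter> left_range b
      \<longrightarrow> EP (a * b))
    \<and> \<comment> \<open>(vi)\<close>
     (EP (a * b) \<longrightarrow>
        left_range (a * b) \<subseteq> left_range a \<and> left_null b \<subseteq> left_null (a * b))
    \<and> \<comment> \<open>(vii)\<close>
     ((left_range (a * b) \<subseteq> left_range a \<longleftrightarrow> a * b * (1 - a * a\<^sup>\<dagger>) = 0) \<and>
      (left_null b \<subseteq> left_null (a * b) \<longleftrightarrow> (1 - b\<^sup>\<dagger> * b) * a * b = 0))
    \<and> \<comment> \<open>(viii)\<close>
     (a * b * (1 - a * a\<^sup>\<dagger>) = 0 \<and> (1 - b\<^sup>\<dagger> * b) * a * b = 0 \<and>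
        finite_dim (left_null a) \<and> finite_dim (left_null b)
      \<longrightarrow> left_null (a * b) = left_null a + left_null b \<and>
          left_range (a * b) = left_range a \<inter> left_range b \<and>
          EP (a * b))"
proof -
  note a = EPD[OF assms(1)] and b = EPD[OF assms(2)]
  note ma = mp_inverseD[OF a(1)] and mb = mp_inverseD[OF b(1)]
  have range_iff: "(1 - b * b\<^sup>\<dagger>) * a * b = 0 \<longleftrightarrow> b * b\<^sup>\<dagger> * (a * b) = a * b"
    and null_iff: "a * b * (1 - a\<^sup>\<dagger> * a) = 0 \<longleftrightarrow> a * b * (a\<^sup>\<dagger> * a) = a * b"
    by (auto simp: algebra_simps)
  \<comment> \<open>Because \<open>a\<close> and \<open>b\<close> are EP, the conditions of the
    left-hand version are those of the right-hand one.\<close>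
  have range_iff': "(1 - b\<^sup>\<dagger> * b) * a * b = 0 \<longleftrightarrow> b * b\<^sup>\<dagger> * (a * b) = a * b"
    and null_iff': "a * b * (1 - a * a\<^sup>\<dagger>) = 0 \<longleftrightarrow> a * b * (a\<^sup>\<dagger> * a) = a * b"
    using range_iff null_iff by (simp_all only: a b)
  note absorb = right_range_subset_iff[OF mb(1)] right_null_subset_iff[OF ma(1)]
    left_range_subset_iff[OF ma(1)] left_null_subset_iff[OF mb(1)]
  \<comment> \<open>\<open>a * b\<close> always absorbs \<open>b * b\<^sup>\<dagger>\<close> on the
    right and \<open>a * a\<^sup>\<dagger>\<close> on the left; being EP moves each to the other
    side.\<close>
  have EP_absorb: "b * b\<^sup>\<dagger> * (a * b) = a * b \<and> a * b * (a\<^sup>\<dagger> * a) = a * b" if "EP (a * b)"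
  proof
    have "a * b * (b * b\<^sup>\<dagger>) = a * b" using mb(1) by (metis b(2) mult.assoc)
    then show "b * b\<^sup>\<dagger> * (a * b) = a * b" by (rule EP_absorb_left[OF that mb(3,5)])
    have "a * a\<^sup>\<dagger> * (a * b) = a * b" using ma(1) by (simp flip: mult.assoc)
    then have "a\<^sup>\<dagger> * a * (a * b) = a * b" by (simp only: a(2))
    then show "a * b * (a\<^sup>\<dagger> * a) = a * b" by (rule EP_absorb_right[OF that ma(4,6)])
  qed
  show ?thesis
    unfolding range_iff null_iff range_iff' null_iff' absorb
    using EP_absorb right_null_range_product[OF assms(1,2)] left_null_range_product[OF assms(1,2)]
      EP_product_right[OF assms] EP_product_left[OF assms] by blast
qed

end
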